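(* Suppose there is a set $E$ of even integers $\ge 6$, of positive lower density among the even numbers (that is, $\liminf_{x\to\infty}\#(E\cap[1,x])/(x/2)>0$), such that every $n\in E$ admits a representation $n=p+t$ with $p$ prime and $t\in\mathcal T$. Then $\mathcal T$ is infinite. In particular, statement (S) implies the twin prime conjecture, and (S) implies the conjunction of the Goldbach conjecture and the twin prime conjecture.
   Context: A prime $t$ is a twin member if $t-2$ or $t+2$ is prime; $\mathcal T$ denotes the set of all twin members. Statement (S): every even $n\ge 6$ admits a representation $n=p+t$ with $p$ prime and $t\in\mathcal T$. The Goldbach conjecture: every even $n\ge 4$ is a sum of two primes. The twin prime conjecture: there are infinitely many primes $p$ such that $p+2$ is prime (equivalently, $\mathcal T$ is infinite). *)

theory Defs
  imports Complex_Main "HOL-Library.Extended_Real" "HOL-Computational_Algebra.Primes"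
begin

text \<open>A prime is at least 2, so the subtraction below never truncates.\<close>

definition twin_members :: "nat set" where
  "twin_members = {t. prime t \<and> (prime (t - 2) \<or> prime (t + 2))}"

definition prime_plus_twin_member :: "nat \<Rightarrow> bool" where
  "prime_plus_twin_member n \<longleftrightarrow> (\<exists>p t. prime p \<and> t \<in> twin_members \<and> n = p + t)"

text \<open>Lower density relative to the even numbers, of which there are about \<open>x / 2\<close> up to \<open>x\<close>;
  the real variable \<open>x\<close> tends to infinity. The limit inferior is taken in the extended reals,
  where it exists without a boundedness condition.\<close>

definition even_lower_density :: "nat set \<Rightarrow> ereal" where
  "even_lower_density E =
     Liminf at_top (\<lambda>x::real. ereal (real (card {n \<in> E. 1 \<le> real n \<and> real n \<le> x}) / (x / 2)))"

definition statement_S :: bool where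
  "statement_S \<longleftrightarrow> (\<forall>n::nat. even n \<and> n \<ge> 6 \<longrightarrow> prime_plus_twin_member n)"

definition goldbach_conjecture :: bool where
  "goldbach_conjecture \<longleftrightarrow>
     (\<forall>n::nat. even n \<and> n \<ge> 4 \<longrightarrow> (\<exists>p q. prime p \<and> prime q \<and> n = p + q))"

definition twin_prime_conjecture :: bool where
  "twin_prime_conjecture \<longleftrightarrow> infinite {p::nat. prime p \<and> prime (p + 2)}"

end

theory Submission
  imports Defs
begin

text \<open>Suppose there are only \<open>k\<close> twin members. Every \<open>n \<in> E\<close> with \<open>n \<le> x\<close> is \<open>p + t\<close> with \<open>p\<close> a
  prime up to \<open>x\<close> and \<open>t\<close> one of \<open>k\<close> values, so \<open>E\<close> has at most \<open>k \<pi>(x)\<close> elements up to \<open>x\<close>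
  (\<open>prime_sums_card_le\<close>). Since the primes have density zero, this contradicts a positive lower
  density of \<open>E\<close>.

  A positive lower density bounds the counting function of \<open>E\<close> from below at all large \<open>x\<close>, so it
  is enough to know that \<open>\<pi>(x) = o(x)\<close> along the powers of two. This is Chebyshev's argument: the
  primes between \<open>N\<close> and \<open>2 N\<close> all divide the central binomial coefficient, which is at most
  \<open>4 ^ N\<close>; for \<open>N = 2 ^ m\<close> no logarithms arise and one gets \<open>\<pi>(2 ^ m) \<le> 4 * 2 ^ m / m\<close>
  (\<open>prime_count_power_two\<close>).

  The consequences for statement (S) follow by letting \<open>E\<close> be the set of all even numbers from 6 on.\<close>

section \<open>Primes up to a power of two\<close>

lemma prod_primes_dvd:
  fixes n :: nat
  assumes "finite A" "\<And>p. p \<in> A \<Longrightarrow> prime p \<and> p dvd n"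
  shows "\<Prod>A dvd n"
  using assms
proof (induction A rule: finite_induct)
  case (insert p A)
  have "coprime p (\<Prod>A)"
    using insert by (intro prod_coprime_right) (metis insertCI primes_coprime)
  with insert show ?case
    by (simp add: divides_mult)
qed simp

text \<open>The primes in question divide \<open>(2 * N)!\<close> but not \<open>N!\<close>, so their product divides the central
  binomial coefficient; each of them exceeds \<open>N\<close>.\<close>

lemma power_card_primes_between_le:
  "N ^ card {p. prime p \<and> N < p \<and> p \<le> 2 * N} \<le> (4::nat) ^ N"
proof -
  define A where "A = {p. prime p \<and> N < p \<and> p \<le> 2 * N}"
  have fin: "finite A"
    unfolding A_def by (rule finite_subset[of _ "{..2 * N}"]) auto
  have dvd: "prime p \<and> p dvd (2 * N) choose N" if "p \<in> A" for p
  proof -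
    have p: "prime p" "N < p" "p \<le> 2 * N"
      using that by (auto simp: A_def)
    have "p dvd fact N * fact N * ((2 * N) choose N)"
      using p binomial_fact_lemma[of N "2 * N"] by (simp add: prime_dvd_fact_iff)
    with p show ?thesis
      by (simp add: prime_dvd_mult_iff prime_dvd_fact_iff)
  qed
  have "N ^ card A = (\<Prod>p\<in>A. N)"
    by simp
  also have "\<dots> \<le> \<Prod>A"
    by (rule prod_mono) (auto simp: A_def)
  also have "\<dots> \<le> (2 * N) choose N"
  proof (rule dvd_imp_le)
    show "\<Prod>A dvd (2 * N) choose N"
      using fin dvd by (rule prod_primes_dvd)
  qed (rule zero_less_binomial, simp)
  also have "\<dots> \<le> (\<Sum>k\<le>2 * N. (2 * N) choose k)"
    by (rule member_le_sum) auto
  also have "\<dots> = 4 ^ N"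
    by (simp add: choose_row_sum power_mult)
  finally show ?thesis
    by (simp add: A_def)
qed

lemma card_primes_dyadic_le:
  "m * card {p::nat. prime p \<and> 2 ^ m < p \<and> p \<le> 2 ^ Suc m} \<le> 2 * 2 ^ m"
proof -
  define b where "b = card {p::nat. prime p \<and> 2 ^ m < p \<and> p \<le> 2 ^ Suc m}"
  have "(2::nat) ^ (m * b) = (2 ^ m) ^ b"
    by (rule power_mult)
  also have "\<dots> \<le> (2 ^ 2) ^ (2 ^ m)"
    using power_card_primes_between_le[of "2 ^ m"] by (simp add: b_def)
  also have "\<dots> = 2 ^ (2 * 2 ^ m)"
    by (rule power_mult[symmetric])
  finally have "m * b \<le> 2 * 2 ^ m"
    by (rule power_le_imp_le_exp[rotated]) simp
  then show ?thesis
    by (simp only: b_def)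
qed

text \<open>Induction over the dyadic blocks: if the claim holds for \<open>m\<close>, then
  \<open>\<pi>(2 ^ (m + 1)) \<le> 4 * 2 ^ m / m + 2 * 2 ^ m / m = 3 * 2 ^ (m + 1) / m\<close>, and \<open>3 / m \<le> 4 / (m + 1)\<close>
  as soon as \<open>m \<ge> 3\<close>. The constant 4 makes the trivial bound \<open>\<pi>(x) \<le> x\<close> suffice up to \<open>m = 4\<close>.\<close>

lemma prime_count_power_two:
  "m * card {p::nat. prime p \<and> p \<le> 2 ^ m} \<le> 4 * 2 ^ m"
proof (induction m)
  case (Suc m)
  define a where "a = card {p::nat. prime p \<and> p \<le> 2 ^ m}"
  define b where "b = card {p::nat. prime p \<and> 2 ^ m < p \<and> p \<le> 2 ^ Suc m}"
  define c where "c = card {p::nat. prime p \<and> p \<le> 2 ^ Suc m}"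
  show ?case
  proof (cases "m \<le> 3")
    case True
    have "c \<le> card {1..2 ^ Suc m :: nat}"
      unfolding c_def by (rule card_mono) (auto dest: prime_ge_1_nat)
    then have "Suc m * c \<le> 4 * 2 ^ Suc m"
      using True by (intro mult_le_mono) auto
    then show ?thesis
      by (simp add: c_def)
  next
    case False
    have "{p::nat. prime p \<and> p \<le> 2 ^ Suc m} =
        {p. prime p \<and> p \<le> 2 ^ m} \<union> {p. prime p \<and> 2 ^ m < p \<and> p \<le> 2 ^ Suc m}"
      by auto
    then have "c \<le> a + b"
      unfolding a_def b_def c_def by (simp only: card_Un_le)
    then have "m * c \<le> m * a + m * b"
      by (metis add_mult_distrib2 mult_le_mono2)
    also have "\<dots> \<le> 6 * 2 ^ m"
      using Suc.IH card_primes_dyadic_le[of m] by (simp add: a_def b_def)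
    finally have 1: "m * c \<le> 6 * 2 ^ m" .
    have "3 * (Suc m * c) \<le> 4 * (m * c)"
      unfolding mult.assoc[symmetric] using False by (intro mult_le_mono1) simp
    also have "\<dots> \<le> 4 * (6 * 2 ^ m)"
      by (intro mult_le_mono2 1)
    also have "\<dots> = 3 * (4 * 2 ^ Suc m)"
      by simp
    finally have "Suc m * c \<le> 4 * 2 ^ Suc m"
      by (rule mult_le_cancel1[THEN iffD1, THEN mp]) simp
    then show ?thesis
      by (simp add: c_def)
  qed
qed simp

section \<open>Infinitely many twin members\<close>

lemma prime_sums_card_le:
  fixes E T :: "nat set"
  assumes "finite T" and "\<And>n. n \<in> E \<Longrightarrow> \<exists>p t. prime p \<and> t \<in> T \<and> n = p + t"
  shows "card {n \<in> E. n \<le> x} \<le> card {p. prime p \<and> p \<le> x} * card T"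
proof -
  define P where "P = {p::nat. prime p \<and> p \<le> x}"
  have fin: "finite (P \<times> T)"
    using assms(1) by (simp add: P_def)
  have "{n \<in> E. n \<le> x} \<subseteq> (\<lambda>(p, t). p + t) ` (P \<times> T)"
  proof
    fix n
    assume n: "n \<in> {n \<in> E. n \<le> x}"
    then obtain p t where pt: "prime p" "t \<in> T" "n = p + t"
      using assms(2) by blast
    with n have "(p, t) \<in> P \<times> T"
      by (simp add: P_def)
    then show "n \<in> (\<lambda>(p, t). p + t) ` (P \<times> T)"
      by (rule rev_image_eqI) (simp add: pt)
  qed
  then have "card {n \<in> E. n \<le> x} \<le> card (P \<times> T)"
    by (rule surj_card_le[OF fin])
  then show ?thesis
    by (simp add: P_def card_cartesian_product)
qed

lemma infinite_twin_members:
  assumes density: "even_lower_density E > 0"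
    and repr: "\<And>n. n \<in> E \<Longrightarrow> prime_plus_twin_member n"
  shows "infinite twin_members"
proof
  assume fin: "finite twin_members"
  define k where "k = card twin_members"
  obtain c :: real where c: "0 < c" "ereal c < even_lower_density E"
    using ereal_dense2[OF density] by (auto simp: zero_ereal_def)
  have "eventually (\<lambda>x::real. ereal c <
      ereal (real (card {n \<in> E. 1 \<le> real n \<and> real n \<le> x}) / (x / 2))) at_top"
    using c(2) unfolding even_lower_density_def by (rule less_LiminfD)
  then obtain X where X: "\<And>x. x \<ge> X \<Longrightarrow>
      c < real (card {n \<in> E. 1 \<le> real n \<and> real n \<le> x}) / (x / 2)"
    by (auto simp: eventually_at_top_linorder)
  \<comment> \<open>\<open>m\<close> beyond \<open>X\<close> puts \<open>2 ^ m\<close> into the range where the density bound holds, and \<open>m\<close> beyond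
    \<open>8 k / c\<close> makes \<open>k \<pi>(2 ^ m)\<close> smaller than \<open>c * 2 ^ m / 2\<close>.\<close>
  obtain m :: nat where m: "real m > max X (8 * real k / c)"
    using reals_Archimedean2 by blast
  define e where "e = card {n \<in> E. n \<le> 2 ^ m}"
  define \<pi> where "\<pi> = card {p::nat. prime p \<and> p \<le> 2 ^ m}"
  have "real m < 2 ^ m"
    by (rule of_nat_less_two_power)
  then have "c < real (card {n \<in> E. 1 \<le> real n \<and> real n \<le> 2 ^ m}) / (2 ^ m / 2)"
    using m by (intro X) linarith
  also have "\<dots> \<le> real e / (2 ^ m / 2)"
  proof (intro divide_right_mono of_nat_mono)
    have "n \<le> 2 ^ m" if "real n \<le> 2 ^ m" for n
      using that by (simp only: numeral_power_le_of_nat_cancel_iff of_nat_le_numeral_power_cancel_iff)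
    then show "card {n \<in> E. 1 \<le> real n \<and> real n \<le> 2 ^ m} \<le> e"
      unfolding e_def by (intro card_mono) auto
  qed simp
  finally have lower: "c * 2 ^ m < 2 * real e"
    by (simp add: field_simps)
  have "e \<le> \<pi> * k"
    unfolding e_def \<pi>_def k_def
    using fin repr by (intro prime_sums_card_le) (auto simp: prime_plus_twin_member_def)
  then have "m * e \<le> k * (m * \<pi>)"
    by (metis mult.commute mult.left_commute mult_le_mono2)
  also have "\<dots> \<le> k * (4 * 2 ^ m)"
    unfolding \<pi>_def by (intro mult_le_mono2 prime_count_power_two)
  finally have "real (m * e) \<le> real (k * (4 * 2 ^ m))"
    by (rule of_nat_mono)
  then have upper: "real m * real e \<le> 4 * real k * 2 ^ m"
    by simp
  have "real m > 8 * real k / c"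
    using m by simp
  then have mc: "8 * real k < real m * c"
    using c(1) by (simp only: pos_divide_less_eq)
  have "0 \<le> 8 * real k / c"
    using c(1) by simp
  with \<open>real m > 8 * real k / c\<close> have "real m > 0"
    by linarith
  have "8 * real k * 2 ^ m < real m * c * 2 ^ m"
    using mc by simp
  also have "\<dots> < real m * (2 * real e)"
    using mult_strict_left_mono[OF lower \<open>real m > 0\<close>] by (simp add: mult.assoc)
  finally show False
    using upper by (simp add: mult_ac)
qed

section \<open>Consequences of statement (S)\<close>

text \<open>The lower density is 1; the bound 1/2 leaves room for the missing even numbers 2 and 4.\<close>

lemma even_lower_density_all_pos:
  "even_lower_density {n. even n \<and> n \<ge> 6} > 0"
proof -
  have "ereal (1 / 2) \<le> even_lower_density {n. even n \<and> n \<ge> 6}"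
    unfolding even_lower_density_def
  proof (rule Liminf_bounded, rule eventually_at_top_linorderI)
    fix x :: real
    assume x: "12 \<le> x"
    define S where "S = {n \<in> {n. even n \<and> n \<ge> 6}. 1 \<le> real n \<and> real n \<le> x}"
    define j where "j = nat \<lfloor>x / 2\<rfloor>"
    have j: "real j \<le> x / 2" "x / 2 < real j + 1"
      using x unfolding j_def by linarith+
    have "S \<subseteq> {..nat \<lfloor>x\<rfloor>}"
      using x by (auto simp: S_def le_nat_floor)
    then have fin: "finite S"
      by (rule finite_subset) simp
    have "(\<lambda>i. 2 * i) ` {3..j} \<subseteq> S"
      using j by (auto simp: S_def)
    then have "card ((\<lambda>i. 2 * i) ` {3..j}) \<le> card S"
      by (rule card_mono[OF fin])
    then have "j \<le> card S + 2"
      by (simp add: card_image inj_on_def)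
    then have "real j \<le> real (card S) + 2"
      by linarith
    with j x have "1 / 2 \<le> real (card S) / (x / 2)"
      by (simp add: field_simps)
    then show "ereal (1 / 2) \<le> ereal (real (card {n \<in> {n. even n \<and> n \<ge> 6}.
        1 \<le> real n \<and> real n \<le> x}) / (x / 2))"
      by (simp add: S_def)
  qed
  then show ?thesis
    by (rule less_le_trans[rotated]) simp
qed

text \<open>A twin member is the smaller or the larger element of a twin pair.\<close>

lemma twin_prime_conjecture_if_infinite_twin_members:
  assumes "infinite twin_members"
  shows twin_prime_conjecture
  unfolding twin_prime_conjecture_def
proof
  define A where "A = {p::nat. prime p \<and> prime (p + 2)}"
  assume "finite {p::nat. prime p \<and> prime (p + 2)}"
  then have "finite (A \<union> (\<lambda>p. p + 2) ` A)"
    by (simp add: A_def)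
  moreover have "twin_members \<subseteq> A \<union> (\<lambda>p. p + 2) ` A"
  proof
    fix t
    assume "t \<in> twin_members"
    then consider "prime t" "prime (t - 2)" | "prime t" "prime (t + 2)"
      by (auto simp: twin_members_def)
    then show "t \<in> A \<union> (\<lambda>p. p + 2) ` A"
    proof cases
      case 1
      then have "t = (t - 2) + 2"
        using prime_ge_2_nat[of t] by simp
      with 1 have "t - 2 \<in> A"
        by (simp add: A_def)
      with \<open>t = (t - 2) + 2\<close> show ?thesis
        by blast
    next
      case 2
      then show ?thesis
        by (simp add: A_def)
    qed
  qed
  ultimately show False
    using assms finite_subset by blast
qed

lemma goldbach_if_statement_S:
  assumes statement_S
  shows goldbach_conjecture
  unfolding goldbach_conjecture_def
proof (intro allI impI)
  fix n :: nat
  assume n: "even n \<and> n \<ge> 4"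
  show "\<exists>p q. prime p \<and> prime q \<and> n = p + q"
  proof (cases "n \<ge> 6")
    case True
    with assms n show ?thesis
      unfolding statement_S_def prime_plus_twin_member_def twin_members_def by blast
  next
    case False
    with n have "n = 4 \<or> n = 5"
      by linarith
    with n have "n = 2 + 2"
      by auto
    then show ?thesis
      using two_is_prime_nat by blast
  qed
qed

theorem proposition1:
  shows "(\<forall>E :: nat set.
            (\<forall>n\<in>E. even n \<and> n \<ge> 6) \<and>
            even_lower_density E > 0 \<and>
            (\<forall>n\<in>E. prime_plus_twin_member n)
            \<longrightarrow> infinite twin_members)
       \<and> (statement_S \<longrightarrow> twin_prime_conjecture)
       \<and> (statement_S \<longrightarrow> goldbach_conjecture \<and> twin_prime_conjecture)"
proof -
  have "twin_prime_conjecture" if statement_S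
    using that unfolding statement_S_def
    by (intro twin_prime_conjecture_if_infinite_twin_members
        infinite_twin_members[OF even_lower_density_all_pos]) simp
  then show ?thesis
    using infinite_twin_members goldbach_if_statement_S by blast
qed

end
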